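(* Assume the continuum hypothesis, and let $\kappa$ be an infinite cardinal. Then $l^\infty(\kappa)$ and $B(l^2(\kappa))$ have regular singular states if and only if $\kappa$ is Ulam measurable.
   Context: A cardinal $\kappa$ is Ulam measurable if there is a nonzero countably additive $\{0,1\}$-valued measure on all subsets of $\kappa$ vanishing on singletons. A state $\phi$ on a von Neumann algebra is regular if $\phi(q_n)=0$ for all $n$ implies $\phi(\bigvee q_n)=0$ for any countable set of projections $\{q_n\}$. A state on $l^\infty(\kappa)$ is singular if it vanishes on finitely supported functions; on $B(l^2(\kappa))$, if it vanishes on the compact operators. *)

theory Defs
  imports "HOL-Analysis.Analysis" "HOL-Library.Equipollence"
begin

definition continuum_hypothesis :: bool where
  "continuum_hypothesis \<longleftrightarrow> (\<forall>S :: real set. countable S \<or> S \<approx> (UNIV :: real set))"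

text \<open>The cardinal kappa is represented by the type 'a (kappa = card of UNIV :: 'a set).
  Ulam measurable: there is a nonzero countably additive {0,1}-valued measure
  on all subsets of 'a vanishing on singletons.\<close>
definition ulam_measurable :: "'a itself \<Rightarrow> bool" where
  "ulam_measurable _ \<longleftrightarrow>
     (\<exists>\<mu> :: 'a set \<Rightarrow> real.
        (\<forall>A. \<mu> A = 0 \<or> \<mu> A = 1) \<and>
        (\<exists>A. \<mu> A \<noteq> 0) \<and>
        (\<forall>x. \<mu> {x} = 0) \<and>
        (\<forall>A :: nat \<Rightarrow> 'a set. disjoint_family A \<longrightarrow> (\<lambda>n. \<mu> (A n)) sums \<mu> (\<Union>n. A n)))"

definition cnonneg :: "complex \<Rightarrow> bool" where
  "cnonneg z \<longleftrightarrow> Im z = 0 \<and> 0 \<le> Re z"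

definition linf :: "('a \<Rightarrow> complex) set" where
  "linf = {f. bounded (range f)}"

definition linf_state :: "(('a \<Rightarrow> complex) \<Rightarrow> complex) \<Rightarrow> bool" where
  "linf_state \<phi> \<longleftrightarrow>
     (\<forall>f\<in>linf. \<forall>g\<in>linf. \<phi> (\<lambda>i. f i + g i) = \<phi> f + \<phi> g) \<and>
     (\<forall>c. \<forall>f\<in>linf. \<phi> (\<lambda>i. c * f i) = c * \<phi> f) \<and>
     (\<forall>f\<in>linf. (\<forall>i. cnonneg (f i)) \<longrightarrow> cnonneg (\<phi> f)) \<and>
     \<phi> (\<lambda>_. 1) = 1"

definition linf_proj :: "('a \<Rightarrow> complex) \<Rightarrow> bool" where
  "linf_proj p \<longleftrightarrow> p \<in> linf \<and> (\<forall>i. p i * p i = p i \<and> cnj (p i) = p i)"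

definition linf_proj_le :: "('a \<Rightarrow> complex) \<Rightarrow> ('a \<Rightarrow> complex) \<Rightarrow> bool" where
  "linf_proj_le p q \<longleftrightarrow> (\<forall>i. q i * p i = p i)"

definition linf_proj_sup :: "(nat \<Rightarrow> 'a \<Rightarrow> complex) \<Rightarrow> ('a \<Rightarrow> complex) \<Rightarrow> bool" where
  "linf_proj_sup q P \<longleftrightarrow> linf_proj P \<and> (\<forall>n. linf_proj_le (q n) P) \<and>
     (\<forall>R. linf_proj R \<longrightarrow> (\<forall>n. linf_proj_le (q n) R) \<longrightarrow> linf_proj_le P R)"

definition linf_regular :: "(('a \<Rightarrow> complex) \<Rightarrow> complex) \<Rightarrow> bool" where
  "linf_regular \<phi> \<longleftrightarrow>
     (\<forall>q :: nat \<Rightarrow> 'a \<Rightarrow> complex. (\<forall>n. linf_proj (q n)) \<longrightarrow> (\<forall>n. \<phi> (q n) = 0) \<longrightarrow>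
        (\<forall>P. linf_proj_sup q P \<longrightarrow> \<phi> P = 0))"

definition linf_singular :: "(('a \<Rightarrow> complex) \<Rightarrow> complex) \<Rightarrow> bool" where
  "linf_singular \<phi> \<longleftrightarrow> (\<forall>f. finite {i. f i \<noteq> 0} \<longrightarrow> \<phi> f = 0)"

definition l2 :: "('a \<Rightarrow> complex) set" where
  "l2 = {f. (\<lambda>i. (cmod (f i))\<^sup>2) summable_on UNIV}"

definition l2_norm :: "('a \<Rightarrow> complex) \<Rightarrow> real" where
  "l2_norm f = sqrt (\<Sum>\<^sub>\<infinity>i. (cmod (f i))\<^sup>2)"

definition l2_inner :: "('a \<Rightarrow> complex) \<Rightarrow> ('a \<Rightarrow> complex) \<Rightarrow> complex" where
  "l2_inner f g = (\<Sum>\<^sub>\<infinity>i. cnj (f i) * g i)"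

text \<open>Bounded operators on l2, represented as functions on 'a \<Rightarrow> complex that
  are linear and bounded on l2, map l2 into l2 and are normalized to 0 outside l2
  (so that each bounded operator has exactly one representative).\<close>
type_synonym 'a op = "('a \<Rightarrow> complex) \<Rightarrow> ('a \<Rightarrow> complex)"

definition bop :: "'a op set" where
  "bop = {T. (\<forall>x\<in>l2. T x \<in> l2) \<and>
             (\<forall>x\<in>l2. \<forall>y\<in>l2. T (\<lambda>i. x i + y i) = (\<lambda>i. T x i + T y i)) \<and>
             (\<forall>c. \<forall>x\<in>l2. T (\<lambda>i. c * x i) = (\<lambda>i. c * T x i)) \<and>
             (\<exists>K. \<forall>x\<in>l2. l2_norm (T x) \<le> K * l2_norm x) \<and>
             (\<forall>x. x \<notin> l2 \<longrightarrow> T x = (\<lambda>_. 0))}"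

definition op_id :: "'a op" where
  "op_id x = (if x \<in> l2 then x else (\<lambda>_. 0))"

definition op_add :: "'a op \<Rightarrow> 'a op \<Rightarrow> 'a op" where
  "op_add S T = (\<lambda>x i. S x i + T x i)"

definition op_scale :: "complex \<Rightarrow> 'a op \<Rightarrow> 'a op" where
  "op_scale c T = (\<lambda>x i. c * T x i)"

definition op_positive :: "'a op \<Rightarrow> bool" where
  "op_positive T \<longleftrightarrow> T \<in> bop \<and> (\<forall>x\<in>l2. cnonneg (l2_inner x (T x)))"

definition bop_state :: "('a op \<Rightarrow> complex) \<Rightarrow> bool" where
  "bop_state \<phi> \<longleftrightarrow>
     (\<forall>S\<in>bop. \<forall>T\<in>bop. \<phi> (op_add S T) = \<phi> S + \<phi> T) \<and>
     (\<forall>c. \<forall>T\<in>bop. \<phi> (op_scale c T) = c * \<phi> T) \<and>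
     (\<forall>T. op_positive T \<longrightarrow> cnonneg (\<phi> T)) \<and>
     \<phi> op_id = 1"

definition op_proj :: "'a op \<Rightarrow> bool" where
  "op_proj P \<longleftrightarrow> P \<in> bop \<and> P \<circ> P = P \<and>
     (\<forall>x\<in>l2. \<forall>y\<in>l2. l2_inner (P x) y = l2_inner x (P y))"

definition op_proj_le :: "'a op \<Rightarrow> 'a op \<Rightarrow> bool" where
  "op_proj_le P Q \<longleftrightarrow> Q \<circ> P = P"

definition op_proj_sup :: "(nat \<Rightarrow> 'a op) \<Rightarrow> 'a op \<Rightarrow> bool" where
  "op_proj_sup q P \<longleftrightarrow> op_proj P \<and> (\<forall>n. op_proj_le (q n) P) \<and>
     (\<forall>R. op_proj R \<longrightarrow> (\<forall>n. op_proj_le (q n) R) \<longrightarrow> op_proj_le P R)"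

definition bop_regular :: "('a op \<Rightarrow> complex) \<Rightarrow> bool" where
  "bop_regular \<phi> \<longleftrightarrow>
     (\<forall>q :: nat \<Rightarrow> 'a op. (\<forall>n. op_proj (q n)) \<longrightarrow> (\<forall>n. \<phi> (q n) = 0) \<longrightarrow>
        (\<forall>P. op_proj_sup q P \<longrightarrow> \<phi> P = 0))"

text \<open>Compact operator: the image of the closed unit ball is relatively compact,
  i.e. (l2 being complete) totally bounded in the l2 norm.\<close>
definition op_compact :: "'a op \<Rightarrow> bool" where
  "op_compact T \<longleftrightarrow> T \<in> bop \<and>
     (\<forall>e>0. \<exists>F. finite F \<and> F \<subseteq> l2 \<and>
        (\<forall>x\<in>l2. l2_norm x \<le> 1 \<longrightarrow> (\<exists>y\<in>F. l2_norm (\<lambda>i. T x i - y i) < e)))"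

definition bop_singular :: "('a op \<Rightarrow> complex) \<Rightarrow> bool" where
  "bop_singular \<phi> \<longleftrightarrow> (\<forall>T. op_compact T \<longrightarrow> \<phi> T = 0)"

end

theory Submission
  imports Defs
begin

text \<open>
  On indicator functions, a regular singular state on \<open>l\<^sup>\<infinity>(\<kappa>)\<close> is a nonzero finitely additive charge
  on all subsets of \<open>\<kappa>\<close> whose null sets form a \<open>\<sigma>\<close>-ideal containing the singletons. If the charge
  has an atom, then it is two-valued there, and \<open>\<kappa>\<close> is Ulam measurable. Otherwise, cut the space
  repeatedly into two pieces, always choosing the smaller piece almost as large as possible. The
  pieces along a branch of the resulting binary tree intersect in a null set: a split of a positive
  intersection would bound from below the mass lost at every step. This gives a map to the
  continuum with null fibres, and pushing forward yields such a charge on the continuum. Under the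
  continuum hypothesis an Ulam matrix, whose rows consist of disjoint sets and whose columns cover
  all but countably many points, then produces uncountably many disjoint positive sets, which is
  absurd. Conversely, integration against an Ulam measure is a regular singular state.

  The operator algebra reduces to the function algebra without any set-theoretic hypothesis, by
  pulling states back along the embedding of functions as diagonal operators and along the map
  sending an operator to its diagonal. The latter preserves regularity because the diagonal entry
  \<open>\<langle>e\<^sub>i, P e\<^sub>i\<rangle>\<close> of a projection vanishes iff \<open>P e\<^sub>i = 0\<close>, a property inherited by suprema.
\<close>

section \<open>Charges on power sets\<close>

locale charge =
  fixes m :: "'a set \<Rightarrow> real"
  assumes nonneg: "0 \<le> m A"
    and additive: "A \<inter> B = {} \<Longrightarrow> m (A \<union> B) = m A + m B"
begin

lemma charge_empty: "m {} = 0"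
  using additive[of "{}" "{}"] by simp

lemma charge_split: "m A = m (A \<inter> B) + m (A - B)"
  using additive[OF Int_Diff_disjoint, of A B] by (simp add: Int_Diff_Un)

lemma charge_mono: "A \<subseteq> B \<Longrightarrow> m A \<le> m B"
  using charge_split[of B A] nonneg[of "B - A"] by (simp add: Int_absorb1)

lemma null_subset: "A \<subseteq> B \<Longrightarrow> m B = 0 \<Longrightarrow> m A = 0"
  using charge_mono[of A B] nonneg[of A] by simp

lemma charge_UN_finite:
  assumes "finite I" "disjoint_family_on A I"
  shows "m (\<Union>i\<in>I. A i) = (\<Sum>i\<in>I. m (A i))"
  using assms
proof (induction I rule: finite_induct)
  case (insert j I)
  have "A j \<inter> (\<Union>i\<in>I. A i) = {}" "disjoint_family_on A I"
    using insert by (auto simp: disjoint_family_on_def)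
  then show ?case
    using insert additive by simp
qed (simp add: charge_empty)

lemma countable_nonnull_disjoint:
  assumes "disjoint_family_on A I"
  shows "countable {i \<in> I. m (A i) \<noteq> 0}"
proof -
  have "(\<lambda>i. m (A i)) summable_on I"
  proof (rule nonneg_bdd_above_summable_on)
    show "bdd_above (sum (\<lambda>i. m (A i)) ` {F. F \<subseteq> I \<and> finite F})"
    proof (rule bdd_aboveI2)
      fix F assume "F \<in> {F. F \<subseteq> I \<and> finite F}"
      then have "(\<Sum>i\<in>F. m (A i)) = m (\<Union>i\<in>F. A i)"
        using charge_UN_finite[of F A] assms disjoint_family_on_mono[of F I A] by auto
      then show "(\<Sum>i\<in>F. m (A i)) \<le> m UNIV"
        using charge_mono by simp
    qed
  qed (rule nonneg)
  then show ?thesis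
    by (intro Infinite_Sum.abs_summable_countable) (simp add: nonneg)
qed

definition atom :: "'a set \<Rightarrow> bool" where
  "atom A \<longleftrightarrow> m A \<noteq> 0 \<and> (\<forall>B. m (A \<inter> B) = 0 \<or> m (A - B) = 0)"

definition split_mass :: "'a set \<Rightarrow> 'a set \<Rightarrow> real" where
  "split_mass A B = min (m (A \<inter> B)) (m (A - B))"

lemma split_mass_nonneg: "0 \<le> split_mass A B"
  by (simp add: split_mass_def nonneg)

lemma split_mass_mono: "A \<subseteq> A' \<Longrightarrow> split_mass A B \<le> split_mass A' B"
  unfolding split_mass_def by (intro min.mono charge_mono) auto

lemma null_or_atom_iff: "m A = 0 \<or> atom A \<longleftrightarrow> (\<forall>B. split_mass A B = 0)"
proof -
  have "split_mass A B = 0 \<longleftrightarrow> m (A \<inter> B) = 0 \<or> m (A - B) = 0" for B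
    using nonneg[of "A \<inter> B"] nonneg[of "A - B"] by (auto simp: split_mass_def min_def)
  moreover have "m (A \<inter> B) = 0" if "m A = 0" for B
    using null_subset[OF _ that] by simp
  ultimately show ?thesis by (auto simp: atom_def)
qed

end

lemma ex_half_optimal:
  fixes f :: "'b \<Rightarrow> real"
  assumes bdd: "bdd_above (range f)" and nonneg: "\<And>x. 0 \<le> f x"
  shows "\<exists>x. \<forall>y. f y \<le> 2 * f x"
proof (cases "\<exists>x. f x > 0")
  case True
  then obtain x where "f x > 0" by blast
  then have "Sup (range f) / 2 < Sup (range f)"
    using cSUP_upper[OF UNIV_I bdd, of x] by simp
  then obtain z where "Sup (range f) / 2 < f z"
    using less_cSUP_iff[OF _ bdd] by blast
  then have "f y \<le> 2 * f z" for y
    using cSUP_upper[OF UNIV_I bdd, of y] by simp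
  then show ?thesis by blast
next
  case False
  then have "f y \<le> 2 * f x" for x y
    using nonneg[of x] by (auto simp: not_less intro: order.trans)
  then show ?thesis by blast
qed

context charge
begin

definition greedy_split :: "'a set \<Rightarrow> 'a set" where
  "greedy_split A = (SOME S. \<forall>B. split_mass A B \<le> 2 * split_mass A S)"

primrec branch :: "'a \<Rightarrow> nat \<Rightarrow> 'a set" where
  "branch x 0 = UNIV"
| "branch x (Suc n) =
    (if x \<in> greedy_split (branch x n) then branch x n \<inter> greedy_split (branch x n)
     else branch x n - greedy_split (branch x n))"

definition address :: "'a \<Rightarrow> nat set" where
  "address x = {n. x \<in> greedy_split (branch x n)}"

lemma greedy_split_half_optimal: "split_mass A B \<le> 2 * split_mass A (greedy_split A)"
proof -
  have "bdd_above (range (split_mass A))"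
    by (rule bdd_aboveI2[of _ _ "m A"]) (simp add: split_mass_def min.coboundedI1 charge_mono)
  then have "\<exists>S. \<forall>B. split_mass A B \<le> 2 * split_mass A S"
    using split_mass_nonneg by (rule ex_half_optimal)
  then have "\<forall>B. split_mass A B \<le> 2 * split_mass A (greedy_split A)"
    unfolding greedy_split_def by (rule someI_ex)
  then show ?thesis ..
qed

lemma mem_branch: "x \<in> branch x n"
  by (induction n) auto

lemma branch_cong_address:
  assumes "address x = address y"
  shows "branch x n = branch y n"
proof (induction n)
  case (Suc n)
  moreover have "x \<in> greedy_split (branch x n) \<longleftrightarrow> y \<in> greedy_split (branch y n)"
    using assms by (auto simp: address_def set_eq_iff)
  ultimately show ?case by simp
qed simp

lemma address_fibre_subset_branch: "address -` {address x} \<subseteq> branch x n"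
  using mem_branch branch_cong_address by blast

lemma branch_Suc_mass:
  "m (branch x (Suc n)) \<le> m (branch x n) - split_mass (branch x n) (greedy_split (branch x n))"
  using charge_split[of "branch x n" "greedy_split (branch x n)"] by (simp add: split_mass_def)

lemma branch_mass:
  assumes "\<And>n. C \<subseteq> branch x n"
  shows "m (branch x n) \<le> m UNIV - real n * (split_mass C B / 2)"
proof (induction n)
  case (Suc n)
  have "split_mass C B \<le> 2 * split_mass (branch x n) (greedy_split (branch x n))"
    using split_mass_mono[OF assms] greedy_split_half_optimal by (rule order.trans)
  then show ?case
    using Suc branch_Suc_mass[of x n] by (simp add: field_simps)
qed simp

lemma address_fibre_null_or_atom: "m (address -` {y}) = 0 \<or> atom (address -` {y})"
proof (cases "y \<in> range address")
  case True
  then obtain x where y: "y = address x" by blast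
  have "split_mass (address -` {y}) B = 0" for B
  proof (rule ccontr)
    let ?d = "split_mass (address -` {y}) B"
    assume "?d \<noteq> 0"
    then have "?d / 2 > 0" using split_mass_nonneg[of "address -` {y}" B] by simp
    then obtain n where "m UNIV < real n * (?d / 2)"
      using reals_Archimedean3 by blast
    moreover have "m (branch x n) \<le> m UNIV - real n * (?d / 2)"
      unfolding y by (rule branch_mass) (rule address_fibre_subset_branch)
    ultimately show False using nonneg[of "branch x n"] by simp
  qed
  then show ?thesis by (simp add: null_or_atom_iff)
next
  case False
  then have "address -` {y} = {}" by auto
  then show ?thesis by (simp add: charge_empty)
qed

end

locale regular_charge = charge +
  assumes null_UN: "(\<And>n. m (A n) = 0) \<Longrightarrow> m (\<Union>n::nat. A n) = 0"

locale regular_singular_charge = regular_charge +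
  assumes nonzero: "m UNIV \<noteq> 0"
    and null_singleton: "m {x} = 0"
begin

lemma null_countable:
  assumes "countable A"
  shows "m A = 0"
proof (cases "A = {}")
  case False
  have "m (\<Union>n. {from_nat_into A n}) = 0"
    by (rule null_UN) (rule null_singleton)
  moreover have "(\<Union>n. {from_nat_into A n}) = A"
    using range_from_nat_into[OF False assms] by auto
  ultimately show ?thesis by simp
qed (simp add: charge_empty)

lemma regular_singular_charge_vimage:
  assumes "\<And>y. m (f -` {y}) = 0"
  shows "regular_singular_charge (\<lambda>Y. m (f -` Y))"
proof
  show "m (f -` (A \<union> B)) = m (f -` A) + m (f -` B)" if "A \<inter> B = {}" for A B
    using that additive[of "f -` A" "f -` B"] by (simp add: vimage_Un flip: vimage_Int)
  show "m (f -` (\<Union>n. A n)) = 0" if "\<And>n::nat. m (f -` A n) = 0" for A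
    unfolding vimage_UN using that by (rule null_UN)
qed (simp_all add: nonneg nonzero assms)

lemma atom_imp_ulam_measurable:
  assumes "atom A"
  shows "ulam_measurable TYPE('a)"
proof -
  define \<mu> :: "'a set \<Rightarrow> real" where "\<mu> B = of_bool (m (A \<inter> B) \<noteq> 0)" for B
  have "(\<lambda>n. \<mu> (B n)) sums \<mu> (\<Union>n. B n)" if disj: "disjoint_family B" for B :: "nat \<Rightarrow> 'a set"
  proof (cases "\<exists>k. m (A \<inter> B k) \<noteq> 0")
    case True
    then obtain k where k: "m (A \<inter> B k) \<noteq> 0" by blast
    then have "m (A - B k) = 0" using assms by (auto simp: atom_def)
    moreover have "A \<inter> B n \<subseteq> A - B k" if "n \<noteq> k" for n
      using disj that by (auto simp: disjoint_family_on_def)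
    ultimately have "m (A \<inter> B n) = 0" if "n \<noteq> k" for n
      using null_subset that by blast
    moreover have "m (A \<inter> (\<Union>n. B n)) \<noteq> 0"
      using k null_subset[of "A \<inter> B k" "A \<inter> (\<Union>n. B n)"] by auto
    ultimately show ?thesis
      using k sums_finite[of "{k}" "\<lambda>n. \<mu> (B n)"] by (simp add: \<mu>_def)
  next
    case False
    then have "m (\<Union>n. A \<inter> B n) = 0" by (intro null_UN) auto
    with False show ?thesis by (simp add: \<mu>_def)
  qed
  moreover have "\<mu> A \<noteq> 0" using assms by (simp add: \<mu>_def atom_def)
  moreover have "\<mu> {x} = 0" for x
    using null_subset[OF _ null_singleton[of x], of "A \<inter> {x}"] by (simp add: \<mu>_def)
  moreover have "\<mu> B = 0 \<or> \<mu> B = 1" for B by (simp add: \<mu>_def)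
  ultimately show ?thesis unfolding ulam_measurable_def by blast
qed

end

section \<open>Ulam matrices and the continuum hypothesis\<close>

definition ulam_matrix :: "'a rel \<Rightarrow> nat \<Rightarrow> 'a \<Rightarrow> 'a set" where
  "ulam_matrix r n b = {a. b \<in> under r a \<and> to_nat_on (under r a) b = n}"

lemma disjoint_family_ulam_matrix:
  assumes "\<And>a. countable (under r a)"
  shows "disjoint_family (ulam_matrix r n)"
  unfolding disjoint_family_on_def ulam_matrix_def
  using inj_on_to_nat_on[OF assms] by (fastforce simp: inj_on_def)

lemma Compl_UN_ulam_matrix_subset_under:
  assumes "linear_order r"
  shows "- (\<Union>n. ulam_matrix r n b) \<subseteq> under r b"
proof
  fix a assume "a \<in> - (\<Union>n. ulam_matrix r n b)"
  then have "(b, a) \<notin> r" by (simp add: ulam_matrix_def under_def)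
  then show "a \<in> under r b"
    using assms by (cases "a = b")
      (auto simp: under_def order_on_defs total_on_def dest: refl_onD)
qed

lemma (in regular_singular_charge) ex_uncountable_under:
  assumes "linear_order (r :: 'a rel)"
  shows "\<exists>a. uncountable (under r a)"
proof (rule ccontr)
  assume "\<not> ?thesis"
  then have under: "countable (under r a)" for a by blast
  have "\<exists>n. m (ulam_matrix r n b) \<noteq> 0" for b
  proof (rule ccontr)
    assume "\<not> ?thesis"
    then have "m (\<Union>n. ulam_matrix r n b) = 0" by (intro null_UN) auto
    moreover have "m (- (\<Union>n. ulam_matrix r n b)) = 0"
      using Compl_UN_ulam_matrix_subset_under[OF assms] under
      by (rule null_countable[OF countable_subset])
    ultimately show False
      using charge_split[of UNIV "\<Union>n. ulam_matrix r n b"] nonzero by (simp add: Compl_eq_Diff_UNIV)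
  qed
  then have cover: "(\<Union>n. {b \<in> UNIV. m (ulam_matrix r n b) \<noteq> 0}) = UNIV" by auto
  have "countable {b \<in> UNIV. m (ulam_matrix r n b) \<noteq> 0}" for n
    by (rule countable_nonnull_disjoint) (rule disjoint_family_ulam_matrix[OF under])
  then have "countable (UNIV :: 'a set)"
    by (subst cover[symmetric]) (rule countable_UN, simp_all)
  then show False
    using null_countable nonzero by simp
qed

lemma continuum_hypothesis_countable_underS:
  includes cardinal_syntax
  assumes CH: continuum_hypothesis and "(UNIV :: 'a set) \<approx> (UNIV :: real set)"
  shows "countable (underS |UNIV :: 'a set| a)"
proof -
  let ?S = "underS |UNIV :: 'a set| a"
  obtain h :: "'a \<Rightarrow> real" where h: "bij h"
    using assms(2) by (auto simp: eqpoll_def)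
  then have inj: "inj_on h ?S" by (meson bij_def inj_on_subset subset_UNIV)
  have "|?S| <o |UNIV :: 'a set|"
    by (rule card_of_underS) (rule card_of_Card_order, simp add: Field_card_of)
  then have "\<not> ?S \<approx> (UNIV :: 'a set)"
    using not_ordLess_ordIso by (metis card_of_ordIso eqpoll_def)
  moreover have "?S \<approx> h ` ?S"
    using inj by (simp add: eqpoll_sym inj_on_image_eqpoll_self)
  ultimately have "\<not> h ` ?S \<approx> (UNIV :: real set)"
    using assms(2) eqpoll_sym eqpoll_trans by metis
  then show ?thesis
    using CH countable_image_inj_eq[OF inj] by (auto simp: continuum_hypothesis_def)
qed

lemma continuum_hypothesis_no_regular_singular_charge:
  includes cardinal_syntax
  assumes continuum_hypothesis "(UNIV :: 'a set) \<approx> (UNIV :: real set)"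
  shows "\<not> regular_singular_charge (m :: 'a set \<Rightarrow> real)"
proof
  assume "regular_singular_charge m"
  moreover have "linear_order |UNIV :: 'a set|"
    using card_of_well_order_on unfolding well_order_on_def by blast
  ultimately obtain a where "uncountable (under |UNIV :: 'a set| a)"
    using regular_singular_charge.ex_uncountable_under by blast
  moreover have "under |UNIV :: 'a set| a \<subseteq> insert a (underS |UNIV :: 'a set| a)"
    by (auto simp: under_def underS_def)
  then have "countable (under |UNIV :: 'a set| a)"
    by (rule countable_subset) (simp add: continuum_hypothesis_countable_underS[OF assms])
  ultimately show False by contradiction
qed

lemma (in regular_singular_charge) continuum_hypothesis_imp_ulam_measurable:
  assumes continuum_hypothesis
  shows "ulam_measurable TYPE('a)"
proof (rule ccontr)
  assume "\<not> ulam_measurable TYPE('a)"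
  then have "m (address -` {y}) = 0" for y
    using address_fibre_null_or_atom atom_imp_ulam_measurable by blast
  then have "regular_singular_charge (\<lambda>Y. m (address -` Y))"
    by (rule regular_singular_charge_vimage)
  then show False
    using continuum_hypothesis_no_regular_singular_charge[OF assms nat_sets_eqpoll_reals] by blast
qed

section \<open>States on bounded functions\<close>

lemma cnonneg_iff: "cnonneg z \<longleftrightarrow> 0 \<le> z"
  by (auto simp: cnonneg_def less_eq_complex_def)

lemma linf_iff: "f \<in> linf \<longleftrightarrow> (\<exists>K. \<forall>i. cmod (f i) \<le> K)"
  by (simp add: linf_def bounded_iff)

lemma linf_add: "f \<in> linf \<Longrightarrow> g \<in> linf \<Longrightarrow> (\<lambda>i. f i + g i) \<in> linf"
  unfolding linf_def mem_Collect_eq by (rule bounded_plus_comp)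

lemma linf_scale: "f \<in> linf \<Longrightarrow> (\<lambda>i. c * f i) \<in> linf"
  unfolding linf_iff norm_mult by (meson mult_left_mono norm_ge_zero)

lemma linf_indicator: "(indicator A :: 'a \<Rightarrow> complex) \<in> linf"
  unfolding linf_iff by (auto intro!: exI[of _ 1] simp: indicator_def)

abbreviation support :: "('a \<Rightarrow> complex) \<Rightarrow> 'a set" where
  "support f \<equiv> {i. f i \<noteq> 0}"

lemma linf_finite_support:
  assumes "finite (support f)"
  shows "f \<in> linf"
proof -
  have "finite (insert 0 (f ` support f))" using assms by simp
  then have "finite (range f)" by (rule finite_subset[rotated]) auto
  then show ?thesis by (simp add: linf_def finite_imp_bounded)
qed

lemma linf_proj_iff_indicator: "linf_proj p \<longleftrightarrow> p = indicator (support p)"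
proof
  assume "linf_proj p"
  then have "p i = 0 \<or> p i = 1" for i
    by (metis linf_proj_def mult_cancel_right1)
  then show "p = indicator (support p)"
    by (auto simp: fun_eq_iff indicator_def)
next
  assume p: "p = indicator (support p)"
  then have "p i = 0 \<or> p i = 1" for i
    by (metis indicator_simps)
  moreover have "p \<in> linf" by (subst p) (rule linf_indicator)
  ultimately show "linf_proj p"
    unfolding linf_proj_def by (metis complex_cnj_one complex_cnj_zero mult_1 mult_zero_left)
qed

lemma linf_proj_indicator: "linf_proj (indicator A)"
  by (simp add: linf_proj_iff_indicator indicator_eq_0_iff)

lemma linf_proj_le_indicator_iff:
  "linf_proj_le (indicator A) (indicator B) \<longleftrightarrow> A \<subseteq> B"
  by (auto simp: linf_proj_le_def indicator_def)

lemma linf_proj_sup_indicator_iff: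
  "linf_proj_sup (\<lambda>n. indicator (A n)) P \<longleftrightarrow> P = indicator (\<Union>n. A n)"
proof
  assume sup: "linf_proj_sup (\<lambda>n. indicator (A n)) P"
  then obtain B where P: "P = indicator B"
    using linf_proj_iff_indicator unfolding linf_proj_sup_def by blast
  have "linf_proj_le (indicator (A n)) (indicator B)" for n
    using sup unfolding P linf_proj_sup_def by blast
  moreover have "linf_proj_le (indicator B) (indicator (\<Union>n. A n))"
  proof -
    have "linf_proj_le (indicator (A n)) (indicator (\<Union>n. A n))" for n
      by (auto simp: linf_proj_le_indicator_iff)
    then show ?thesis
      using sup linf_proj_indicator unfolding P linf_proj_sup_def by blast
  qed
  ultimately have "B = (\<Union>n. A n)"
    unfolding linf_proj_le_indicator_iff by blast
  then show "P = indicator (\<Union>n. A n)" by (simp only: P)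
next
  assume P: "P = indicator (\<Union>n. A n)"
  have "linf_proj_le P R" if R: "linf_proj R" and le: "\<forall>n. linf_proj_le (indicator (A n)) R" for R
  proof -
    obtain B where "R = indicator B" using R linf_proj_iff_indicator by blast
    then show ?thesis
      using le by (auto simp: P linf_proj_le_indicator_iff)
  qed
  moreover have "linf_proj_le (indicator (A n)) P" for n
    by (auto simp: P linf_proj_le_indicator_iff)
  ultimately show "linf_proj_sup (\<lambda>n. indicator (A n)) P"
    by (simp add: linf_proj_sup_def P linf_proj_indicator)
qed

lemma linf_regular_iff:
  "linf_regular \<phi> \<longleftrightarrow>
     (\<forall>A :: nat \<Rightarrow> 'a set. (\<forall>n. \<phi> (indicator (A n)) = 0) \<longrightarrow> \<phi> (indicator (\<Union>n. A n)) = 0)"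
proof
  assume "linf_regular \<phi>"
  then show "\<forall>A :: nat \<Rightarrow> 'a set. (\<forall>n. \<phi> (indicator (A n)) = 0) \<longrightarrow> \<phi> (indicator (\<Union>n. A n)) = 0"
    unfolding linf_regular_def using linf_proj_indicator linf_proj_sup_indicator_iff by metis
next
  assume null_UN: "\<forall>A :: nat \<Rightarrow> 'a set. (\<forall>n. \<phi> (indicator (A n)) = 0) \<longrightarrow> \<phi> (indicator (\<Union>n. A n)) = 0"
  show "linf_regular \<phi>"
    unfolding linf_regular_def
  proof (intro allI impI)
    fix q :: "nat \<Rightarrow> 'a \<Rightarrow> complex" and P
    assume q: "\<forall>n. linf_proj (q n)" "\<forall>n. \<phi> (q n) = 0" and P: "linf_proj_sup q P"
    have q_indicator: "q n = indicator (support (q n))" for n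
      using q(1) linf_proj_iff_indicator by blast
    have "linf_proj_sup (\<lambda>n. indicator (support (q n))) P"
      using P by (simp only: q_indicator[symmetric])
    then have "P = indicator (\<Union>n. support (q n))"
      by (simp only: linf_proj_sup_indicator_iff)
    moreover have "\<phi> (indicator (support (q n))) = 0" for n
      using q(2) by (simp only: q_indicator[symmetric])
    ultimately show "\<phi> P = 0"
      using null_UN by simp
  qed
qed

definition state_charge :: "(('a \<Rightarrow> complex) \<Rightarrow> complex) \<Rightarrow> 'a set \<Rightarrow> real" where
  "state_charge \<phi> A = Re (\<phi> (indicator A))"

context
  fixes \<phi> :: "('a \<Rightarrow> complex) \<Rightarrow> complex"
  assumes state: "linf_state \<phi>"
begin

lemma linf_state_add: "f \<in> linf \<Longrightarrow> g \<in> linf \<Longrightarrow> \<phi> (\<lambda>i. f i + g i) = \<phi> f + \<phi> g"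
  using state by (simp add: linf_state_def)

lemma linf_state_scale: "f \<in> linf \<Longrightarrow> \<phi> (\<lambda>i. c * f i) = c * \<phi> f"
  using state by (simp add: linf_state_def)

lemma linf_state_nonneg: "f \<in> linf \<Longrightarrow> (\<And>i. 0 \<le> f i) \<Longrightarrow> 0 \<le> \<phi> f"
  using state by (simp add: linf_state_def cnonneg_iff)

lemma linf_state_mono:
  assumes f: "f \<in> linf" and g: "g \<in> linf" and le: "\<And>i. f i \<le> g i"
  shows "\<phi> f \<le> \<phi> g"
proof -
  have "0 \<le> \<phi> (\<lambda>i. g i + (- 1) * f i)"
    using le by (intro linf_state_nonneg linf_add linf_scale f g) simp
  also have "\<dots> = \<phi> g + (- 1) * \<phi> f"
    by (simp only: linf_state_add[OF g linf_scale[OF f]] linf_state_scale[OF f])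
  finally show ?thesis by simp
qed

lemma linf_state_indicator_nonneg: "0 \<le> \<phi> (indicator A)"
  by (intro linf_state_nonneg linf_indicator) (simp add: indicator_def less_eq_complex_def)

lemma of_real_state_charge: "of_real (state_charge \<phi> A) = \<phi> (indicator A)"
  using linf_state_indicator_nonneg[of A]
  by (simp add: state_charge_def less_eq_complex_def complex_eq_iff)

lemma state_charge_eq_0_iff: "state_charge \<phi> A = 0 \<longleftrightarrow> \<phi> (indicator A) = 0"
  by (simp flip: of_real_state_charge)

lemma charge_state_charge: "charge (state_charge \<phi>)"
proof
  show "0 \<le> state_charge \<phi> A" for A
    using linf_state_indicator_nonneg[of A] by (simp add: state_charge_def less_eq_complex_def)
  show "state_charge \<phi> (A \<union> B) = state_charge \<phi> A + state_charge \<phi> B" if "A \<inter> B = {}" for A B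
  proof -
    have "(indicator (A \<union> B) :: 'a \<Rightarrow> complex) = (\<lambda>i. indicator A i + indicator B i)"
      using that by (auto simp: indicator_def fun_eq_iff)
    then show ?thesis
      by (simp add: state_charge_def linf_state_add linf_indicator)
  qed
qed

lemma linf_state_eq_0_if_null_support_real:
  assumes f: "f \<in> linf" and real: "\<And>i. f i \<in> \<real>"
    and support: "support f \<subseteq> N" and null: "\<phi> (indicator N) = 0"
  shows "\<phi> f = 0"
proof -
  obtain K where K: "\<And>i. cmod (f i) \<le> K" using f by (auto simp: linf_iff)
  have abs: "\<bar>Re (f i)\<bar> \<le> K" for i
    using abs_Re_le_cmod[of "f i"] K[of i] by simp
  have vanishes: "f i = 0" if "i \<notin> N" for i
    using support that by blast
  have dominated: "- of_real K * indicator N i \<le> f i" "f i \<le> of_real K * indicator N i" for i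
    using abs[of i] real[of i] vanishes[of i]
    by (auto simp: less_eq_complex_def indicator_def complex_is_Real_iff abs_le_iff)
  have "\<phi> (\<lambda>i. - of_real K * indicator N i) \<le> \<phi> f" "\<phi> f \<le> \<phi> (\<lambda>i. of_real K * indicator N i)"
    by (intro linf_state_mono f linf_scale linf_indicator dominated)+
  then show ?thesis
    using null by (simp only: linf_state_scale[OF linf_indicator]) (simp add: order.antisym)
qed

lemma linf_state_eq_0_if_null_support:
  assumes f: "f \<in> linf" and support: "support f \<subseteq> N" and null: "\<phi> (indicator N) = 0"
  shows "\<phi> f = 0"
proof -
  define g h where "g i = complex_of_real (Re (f i))" and "h i = complex_of_real (Im (f i))" for i
  obtain K where "\<And>i. cmod (f i) \<le> K" using f by (auto simp: linf_iff)
  then have linf: "g \<in> linf" "h \<in> linf"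
    unfolding linf_iff g_def h_def norm_of_real
    by (meson abs_Re_le_cmod abs_Im_le_cmod order.trans)+
  have "\<phi> g = 0"
    by (rule linf_state_eq_0_if_null_support_real[OF linf(1) _ _ null])
      (use support in \<open>auto simp: g_def\<close>)
  moreover have "\<phi> h = 0"
    by (rule linf_state_eq_0_if_null_support_real[OF linf(2) _ _ null])
      (use support in \<open>auto simp: h_def\<close>)
  moreover have "f = (\<lambda>i. g i + \<i> * h i)"
    by (simp add: g_def h_def fun_eq_iff flip: complex_eq)
  ultimately show ?thesis
    using linf by (simp add: linf_state_add linf_state_scale linf_scale)
qed

lemma linf_singular_iff: "linf_singular \<phi> \<longleftrightarrow> (\<forall>i. \<phi> (indicator {i}) = 0)"
proof
  assume "linf_singular \<phi>"
  moreover have "{j. indicator {i} j \<noteq> (0 :: complex)} = {i}" for i :: 'a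
    by (auto simp: indicator_def)
  ultimately show "\<forall>i. \<phi> (indicator {i}) = 0"
    by (simp add: linf_singular_def)
next
  assume "\<forall>i. \<phi> (indicator {i}) = 0"
  then have null_singleton: "state_charge \<phi> {i} = 0" for i
    by (simp add: state_charge_eq_0_iff)
  show "linf_singular \<phi>"
    unfolding linf_singular_def
  proof (intro allI impI)
    fix f :: "'a \<Rightarrow> complex" assume fin: "finite (support f)"
    then have "state_charge \<phi> (\<Union>i\<in>support f. {i}) = 0"
      by (subst charge.charge_UN_finite[OF charge_state_charge])
        (auto simp: disjoint_family_on_def null_singleton)
    then have "\<phi> (indicator (support f)) = 0"
      by (simp add: state_charge_eq_0_iff)
    then show "\<phi> f = 0"
      by (rule linf_state_eq_0_if_null_support[OF linf_finite_support[OF fin] subset_refl])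
  qed
qed

lemma regular_singular_charge_state_charge:
  assumes regular: "linf_regular \<phi>" and singular: "linf_singular \<phi>"
  shows "regular_singular_charge (state_charge \<phi>)"
proof -
  interpret charge "state_charge \<phi>" by (rule charge_state_charge)
  show ?thesis
  proof
    show "state_charge \<phi> (\<Union>n. A n) = 0" if "\<And>n::nat. state_charge \<phi> (A n) = 0" for A
      using regular that by (simp add: linf_regular_iff state_charge_eq_0_iff)
    have "(indicator UNIV :: 'a \<Rightarrow> complex) = (\<lambda>_. 1)" by auto
    then show "state_charge \<phi> UNIV \<noteq> 0"
      using state by (simp add: state_charge_eq_0_iff linf_state_def)
    show "state_charge \<phi> {i} = 0" for i
      using singular by (simp add: linf_singular_iff state_charge_eq_0_iff)
  qed
qed

lemma linf_state_support_null:
  assumes regular: "linf_regular \<phi>"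
    and f: "f \<in> linf" "\<And>i. 0 \<le> f i" and null: "\<phi> f = 0"
  shows "\<phi> (indicator (support f)) = 0"
proof -
  let ?A = "\<lambda>n. {i. 1 \<le> real n * Re (f i)}"
  have "\<phi> (indicator (?A n)) = 0" for n
  proof (rule order.antisym)
    have "\<phi> (indicator (?A n)) \<le> \<phi> (\<lambda>i. of_nat n * f i)"
      using f(2) by (intro linf_state_mono linf_indicator linf_scale f(1))
        (auto simp: indicator_def less_eq_complex_def)
    then show "\<phi> (indicator (?A n)) \<le> 0"
      by (simp add: linf_state_scale f null)
    show "0 \<le> \<phi> (indicator (?A n))"
      by (rule linf_state_indicator_nonneg)
  qed
  moreover have "support f = (\<Union>n. ?A n)"
  proof (intro equalityI subsetI)
    fix i assume "i \<in> support f"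
    then have "0 < Re (f i)"
      using f(2)[of i] by (auto simp: less_eq_complex_def complex_eq_iff)
    then show "i \<in> (\<Union>n. ?A n)"
      using reals_Archimedean3[of "Re (f i)"] by (auto intro: less_imp_le)
  qed auto
  ultimately show ?thesis
    using regular by (simp add: linf_regular_iff)
qed

end

lemma regular_singular_linf_state_imp_ulam_measurable:
  assumes continuum_hypothesis
    and "linf_state \<phi>" "linf_regular \<phi>" "linf_singular (\<phi> :: ('a \<Rightarrow> complex) \<Rightarrow> complex)"
  shows "ulam_measurable TYPE('a)"
  using regular_singular_charge_state_charge[OF assms(2-4)] assms(1)
  by (rule regular_singular_charge.continuum_hypothesis_imp_ulam_measurable)

section \<open>Integration against an Ulam measure\<close>

lemma ulam_measurable_imp_measure:
  assumes "ulam_measurable TYPE('a)"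
  obtains M :: "'a measure" where "sets M = UNIV" "emeasure M UNIV = 1" "\<forall>i. emeasure M {i} = 0"
proof -
  obtain \<mu> :: "'a set \<Rightarrow> real" where two_valued: "\<And>A. \<mu> A = 0 \<or> \<mu> A = 1"
    and nonzero: "\<exists>A. \<mu> A \<noteq> 0" and null_singleton: "\<And>i. \<mu> {i} = 0"
    and sums: "\<And>A :: nat \<Rightarrow> 'a set. disjoint_family A \<Longrightarrow> (\<lambda>n. \<mu> (A n)) sums \<mu> (\<Union>n. A n)"
    using assms unfolding ulam_measurable_def by auto
  define M where "M = measure_of UNIV (Pow UNIV) (\<lambda>A. ennreal (\<mu> A))"
  have sets: "sets M = UNIV"
    unfolding M_def
    by (subst sigma_algebra.sets_measure_of_eq[OF sigma_algebra_Pow]) simp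
  have "(\<lambda>n::nat. \<mu> {}) sums \<mu> {}"
    using sums[of "\<lambda>_. {}"] by (simp add: disjoint_family_on_def)
  then have "\<mu> {} = 0"
    using sums_summable summable_const_iff by blast
  moreover have "(\<Sum>n. ennreal (\<mu> (A n))) = ennreal (\<mu> (\<Union>n. A n))" if "disjoint_family A" for A
    using sums[OF that] two_valued by (intro suminf_ennreal_eq) (metis order_refl zero_le_one)
  ultimately have emeasure: "emeasure M A = ennreal (\<mu> A)" for A
    by (intro emeasure_measure_of[OF M_def])
      (simp_all add: sets positive_def countably_additive_def)
  obtain A where "\<mu> A = 1" using nonzero two_valued by blast
  then have "emeasure M UNIV \<ge> 1"
    using emeasure_mono[of A UNIV M] by (simp add: sets emeasure)
  then have "emeasure M UNIV = 1"
    using two_valued[of UNIV] by (auto simp: emeasure)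
  with sets show thesis
    by (rule that) (simp add: emeasure null_singleton)
qed

context
  fixes M :: "'a measure"
  assumes sets: "sets M = UNIV" and prob: "emeasure M UNIV = 1"
begin

lemma space_eq_UNIV: "space M = UNIV"
  using sets sets.sets_into_space by blast

lemma finite_measure_prob: "finite_measure M"
  by (rule finite_measureI) (simp add: space_eq_UNIV prob)

lemma integrable_linf:
  assumes "f \<in> linf"
  shows "integrable M f"
proof -
  interpret finite_measure M by (rule finite_measure_prob)
  obtain K where "\<And>i. cmod (f i) \<le> K" using assms by (auto simp: linf_iff)
  moreover have "f \<in> borel_measurable M" by (simp add: measurable_def sets space_eq_UNIV)
  ultimately show ?thesis by (intro integrable_const_bound[of _ K]) auto
qed

lemma integral_indicator_eq_measure: "(LINT i|M. indicator A i) = complex_of_real (measure M A)"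
proof -
  have "(LINT i|M. indicator A i) = (LINT i|M. complex_of_real (indicator A i))"
    by (intro Bochner_Integration.integral_cong) (auto simp: indicator_def)
  then show ?thesis by (simp add: space_eq_UNIV)
qed

lemma linf_state_integral: "linf_state (\<lambda>f. LINT i|M. f i)"
proof -
  have "0 \<le> (LINT i|M. f i)" if nonneg: "\<And>i. 0 \<le> f i" for f :: "'a \<Rightarrow> complex"
  proof -
    have "(LINT i|M. f i) = (LINT i|M. complex_of_real (Re (f i)))"
      using nonneg by (intro Bochner_Integration.integral_cong)
        (auto simp: less_eq_complex_def complex_eq_iff)
    moreover have "0 \<le> (LINT i|M. Re (f i))"
      using nonneg by (intro Bochner_Integration.integral_nonneg) (simp add: less_eq_complex_def)
    ultimately show ?thesis by (simp add: less_eq_complex_def)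
  qed
  moreover have "measure M UNIV = 1" by (simp add: measure_def prob)
  ultimately show ?thesis
    by (simp add: linf_state_def cnonneg_iff integrable_linf space_eq_UNIV)
qed

lemma linf_regular_integral: "linf_regular (\<lambda>f. LINT i|M. f i)"
proof -
  interpret finite_measure M by (rule finite_measure_prob)
  have "measure M (\<Union>n. A n) = 0" if "\<And>n. measure M (A n) = 0" for A :: "nat \<Rightarrow> 'a set"
    using that null_sets_UN[of A M] by (simp add: null_sets_def sets emeasure_eq_measure)
  then show ?thesis by (simp add: linf_regular_iff integral_indicator_eq_measure)
qed

lemma linf_singular_integral:
  assumes "\<forall>i. emeasure M {i} = 0"
  shows "linf_singular (\<lambda>f. LINT i|M. f i)"
  using assms
  by (simp add: linf_singular_iff linf_state_integral integral_indicator_eq_measure measure_def)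

end

lemma ulam_measurable_imp_ex_regular_singular_linf_state:
  assumes "ulam_measurable TYPE('a)"
  shows "\<exists>\<phi> :: ('a \<Rightarrow> complex) \<Rightarrow> complex. linf_state \<phi> \<and> linf_regular \<phi> \<and> linf_singular \<phi>"
proof -
  obtain M :: "'a measure"
    where M: "sets M = UNIV" "emeasure M UNIV = 1" "\<forall>i. emeasure M {i} = 0"
    using assms by (rule ulam_measurable_imp_measure)
  show ?thesis
    by (intro exI[of _ "\<lambda>f. LINT i|M. f i"] conjI linf_state_integral linf_regular_integral
        linf_singular_integral M)
qed

section \<open>Square-summable functions\<close>

lemma l2_zero: "(\<lambda>_. 0) \<in> l2"
  by (simp add: l2_def)

lemma l2_add:
  assumes "x \<in> l2" "y \<in> l2"
  shows "(\<lambda>i. x i + y i) \<in> l2"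
proof -
  have "(\<lambda>i. 2 * (cmod (x i))\<^sup>2 + 2 * (cmod (y i))\<^sup>2) summable_on UNIV"
    using assms by (intro summable_on_add summable_on_cmult_right) (auto simp: l2_def)
  moreover have "(cmod (x i + y i))\<^sup>2 \<le> 2 * (cmod (x i))\<^sup>2 + 2 * (cmod (y i))\<^sup>2" for i
  proof -
    have "(cmod (x i + y i))\<^sup>2 \<le> (cmod (x i) + cmod (y i))\<^sup>2"
      by (intro power_mono norm_triangle_ineq) simp
    also have "\<dots> \<le> 2 * (cmod (x i))\<^sup>2 + 2 * (cmod (y i))\<^sup>2"
      using sum_squares_bound[of "cmod (x i)" "cmod (y i)"]
      by (simp add: power2_eq_square algebra_simps)
    finally show ?thesis .
  qed
  ultimately show ?thesis
    unfolding l2_def by (auto intro: summable_on_comparison_test)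
qed

lemma l2_scale: "x \<in> l2 \<Longrightarrow> (\<lambda>i. c * x i) \<in> l2"
  by (simp add: l2_def norm_mult power_mult_distrib summable_on_cmult_right)

lemma l2_diff: "x \<in> l2 \<Longrightarrow> y \<in> l2 \<Longrightarrow> (\<lambda>i. x i - y i) \<in> l2"
  using l2_add[of x "\<lambda>i. (-1) * y i"] l2_scale[of y "-1"] by simp

lemma l2_norm_scale: "l2_norm (\<lambda>i. c * x i) = cmod c * l2_norm x"
  by (simp add: l2_norm_def norm_mult power_mult_distrib infsum_cmult_right' real_sqrt_mult)

lemma l2_dominated:
  assumes "y \<in> l2" "\<And>i. cmod (x i) \<le> cmod (y i)"
  shows "x \<in> l2" and "l2_norm x \<le> l2_norm y"
proof -
  have le: "(cmod (x i))\<^sup>2 \<le> (cmod (y i))\<^sup>2" for i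
    using assms(2) by (intro power_mono) simp_all
  show x: "x \<in> l2"
    using assms(1) le unfolding l2_def by (auto intro: summable_on_comparison_test)
  show "l2_norm x \<le> l2_norm y"
    using x assms(1) le unfolding l2_norm_def l2_def by (auto intro!: infsum_mono)
qed

lemma infsum_eq_single:
  assumes "\<And>j. j \<noteq> i \<Longrightarrow> f j = 0"
  shows "infsum f UNIV = f i"
proof -
  have "infsum f UNIV = infsum f {i}"
    by (rule infsum_cong_neutral) (use assms in auto)
  then show ?thesis by simp
qed

lemma cmod_le_l2_norm:
  assumes "x \<in> l2"
  shows "cmod (x i) \<le> l2_norm x"
proof -
  have "(\<Sum>j\<in>{i}. (cmod (x j))\<^sup>2) \<le> (\<Sum>\<^sub>\<infinity>j. (cmod (x j))\<^sup>2)"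
    using assms by (intro finite_sum_le_infsum) (auto simp: l2_def)
  then show ?thesis
    by (simp add: l2_norm_def real_le_rsqrt)
qed

lemma l2_inner_self:
  assumes "x \<in> l2"
  shows "l2_inner x x = of_real ((l2_norm x)\<^sup>2)"
proof -
  have "cnj (x i) * x i = of_real ((cmod (x i))\<^sup>2)" for i
    by (metis complex_norm_square mult.commute of_real_power)
  then have "l2_inner x x = (\<Sum>\<^sub>\<infinity>i. of_real ((cmod (x i))\<^sup>2))"
    by (simp add: l2_inner_def)
  also have "\<dots> = of_real (\<Sum>\<^sub>\<infinity>i. (cmod (x i))\<^sup>2)"
    using assms by (intro infsumI has_sum_of_real has_sum_infsum) (simp add: l2_def)
  also have "(\<Sum>\<^sub>\<infinity>i. (cmod (x i))\<^sup>2) = (l2_norm x)\<^sup>2"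
    by (simp add: l2_norm_def infsum_nonneg)
  finally show ?thesis .
qed

lemma l2_norm_eq_0D: "x \<in> l2 \<Longrightarrow> l2_norm x = 0 \<Longrightarrow> x = (\<lambda>_. 0)"
  using cmod_le_l2_norm[of x] by (simp add: fun_eq_iff)

lemma l2_countable_support:
  assumes "x \<in> l2"
  shows "countable (support x)"
proof -
  have "countable {i \<in> UNIV. (cmod (x i))\<^sup>2 \<noteq> 0}"
    using assms by (intro Infinite_Sum.abs_summable_countable) (simp add: l2_def)
  then show ?thesis by simp
qed

abbreviation basis_vec :: "'a \<Rightarrow> 'a \<Rightarrow> complex" where
  "basis_vec i \<equiv> indicator {i}"

lemma basis_vec_l2: "basis_vec i \<in> l2"
proof -
  have "(\<lambda>j. (cmod (basis_vec i j))\<^sup>2) summable_on {i}" by simp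
  then show ?thesis
    unfolding l2_def mem_Collect_eq
    by (rule summable_on_cong_neutral[THEN iffD1, rotated -1]) (auto simp: indicator_def)
qed

lemma l2_norm_basis_vec: "l2_norm (basis_vec i) = 1"
  unfolding l2_norm_def by (subst infsum_eq_single[of i]) (auto simp: indicator_def)

lemma l2_inner_basis_vec: "l2_inner (basis_vec i) x = x i"
  unfolding l2_inner_def by (subst infsum_eq_single[of i]) (auto simp: indicator_def)

section \<open>Diagonal operators and diagonals of operators\<close>

definition diag_op :: "('a \<Rightarrow> complex) \<Rightarrow> 'a op" where
  "diag_op f x = (if x \<in> l2 then (\<lambda>i. f i * x i) else (\<lambda>_. 0))"

abbreviation coord_proj :: "'a set \<Rightarrow> 'a op" where
  "coord_proj A \<equiv> diag_op (indicator A)"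

definition diagonal :: "'a op \<Rightarrow> 'a \<Rightarrow> complex" where
  "diagonal T i = T (basis_vec i) i"

lemma bop_l2: "T \<in> bop \<Longrightarrow> T x \<in> l2"
  by (cases "x \<in> l2") (auto simp: bop_def l2_zero)

lemma diag_op_bop:
  assumes "f \<in> linf"
  shows "diag_op f \<in> bop"
proof -
  obtain K where K: "\<And>i. cmod (f i) \<le> K" using assms by (auto simp: linf_iff)
  have dominated: "cmod (f i * x i) \<le> cmod (of_real K * x i)" for x i
    using K[of i] by (auto simp: norm_mult intro: mult_right_mono)
  have l2: "(\<lambda>i. f i * x i) \<in> l2" if "x \<in> l2" for x
    using l2_scale[OF that] dominated by (rule l2_dominated(1))
  have "l2_norm (\<lambda>i. f i * x i) \<le> cmod (of_real K) * l2_norm x" if "x \<in> l2" for x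
    unfolding l2_norm_scale[symmetric] using l2_scale[OF that] dominated by (rule l2_dominated(2))
  then have "\<exists>K. \<forall>x\<in>l2. l2_norm (\<lambda>i. f i * x i) \<le> K * l2_norm x" by blast
  then show ?thesis
    by (simp add: bop_def diag_op_def l2 l2_add l2_scale distrib_left mult.left_commute)
qed

lemma diag_op_l2: "f \<in> linf \<Longrightarrow> diag_op f x \<in> l2"
  by (intro bop_l2 diag_op_bop)

lemma diag_op_add: "diag_op (\<lambda>i. f i + g i) = op_add (diag_op f) (diag_op g)"
  by (auto simp: diag_op_def op_add_def fun_eq_iff algebra_simps)

lemma diag_op_scale: "diag_op (\<lambda>i. c * f i) = op_scale c (diag_op f)"
  by (auto simp: diag_op_def op_scale_def fun_eq_iff)

lemma diag_op_one: "diag_op (\<lambda>_. 1) = op_id"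
  by (auto simp: diag_op_def op_id_def fun_eq_iff)

lemma diag_op_positive:
  assumes "f \<in> linf" and nonneg: "\<And>i. 0 \<le> f i"
  shows "op_positive (diag_op f)"
proof -
  have "0 \<le> l2_inner x (diag_op f x)" if "x \<in> l2" for x
  proof -
    have "0 \<le> cnj z * z" for z
      by (simp add: less_eq_complex_def)
    then have "0 \<le> f i * (cnj (x i) * x i)" for i
      using nonneg by (rule mult_nonneg_nonneg[rotated])
    then have "0 \<le> cnj (x i) * diag_op f x i" for i
      using that by (simp add: diag_op_def mult.left_commute)
    then show ?thesis
      unfolding l2_inner_def
      by (cases "(\<lambda>i. cnj (x i) * diag_op f x i) summable_on UNIV")
        (simp_all add: infsum_nonneg_complex infsum_not_exists)
  qed
  then show ?thesis
    using assms(1) by (simp add: op_positive_def cnonneg_iff diag_op_bop)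
qed

lemma coord_proj_coord_proj_subset:
  assumes "A \<subseteq> B"
  shows "coord_proj B (coord_proj A x) = coord_proj A x"
  using assms diag_op_l2[OF linf_indicator, of A x]
  by (auto simp: diag_op_def indicator_def fun_eq_iff)

lemma op_proj_coord_proj: "op_proj (coord_proj A)"
proof -
  have "coord_proj A \<circ> coord_proj A = coord_proj A"
    by (rule ext) (simp add: coord_proj_coord_proj_subset)
  moreover have "l2_inner (coord_proj A x) y = l2_inner x (coord_proj A y)"
    if "x \<in> l2" "y \<in> l2" for x y
    unfolding l2_inner_def by (rule infsum_cong) (simp add: diag_op_def indicator_def that)
  ultimately show ?thesis
    by (simp add: op_proj_def diag_op_bop linf_indicator)
qed

lemma op_proj_le_iff: "op_proj_le P Q \<longleftrightarrow> (\<forall>x. Q (P x) = P x)"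
  by (simp add: op_proj_le_def fun_eq_iff)

lemma op_proj_idem: "op_proj P \<Longrightarrow> P (P x) = P x"
  by (metis comp_apply op_proj_def)

lemma op_proj_apply:
  assumes "op_proj P" "x \<in> l2"
  shows "P x i = l2_inner (P (basis_vec i)) x"
  using assms l2_inner_basis_vec[of i "P x"] by (simp add: op_proj_def basis_vec_l2)

lemma op_proj_fixes_supported:
  assumes P: "op_proj P" and x: "x \<in> l2"
    and fixed: "\<And>i. x i \<noteq> 0 \<Longrightarrow> P (basis_vec i) = basis_vec i"
  shows "P x = x"
proof
  fix j
  have "cnj (P (basis_vec j) i) * x i = cnj (basis_vec j i) * x i" for i
  proof (cases "x i = 0")
    case False
    have "P (basis_vec j) i = l2_inner (P (basis_vec i)) (basis_vec j)"
      by (rule op_proj_apply[OF P basis_vec_l2])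
    also have "\<dots> = basis_vec j i"
      by (simp add: fixed[OF False] l2_inner_basis_vec)
    finally show ?thesis by simp
  qed simp
  then have "l2_inner (P (basis_vec j)) x = l2_inner (basis_vec j) x"
    unfolding l2_inner_def by (rule infsum_cong)
  then show "P x j = x j"
    by (simp add: op_proj_apply[OF P x] l2_inner_basis_vec)
qed

lemma coord_proj_basis_vec:
  "i \<in> A \<Longrightarrow> coord_proj A (basis_vec i) = basis_vec i"
  by (auto simp: diag_op_def basis_vec_l2 indicator_def fun_eq_iff)

lemma op_proj_le_coord_proj_mono: "A \<subseteq> B \<Longrightarrow> op_proj_le (coord_proj A) (coord_proj B)"
  by (simp add: op_proj_le_iff coord_proj_coord_proj_subset)

lemma op_proj_sup_coord_proj:
  "op_proj_sup (\<lambda>n. coord_proj (A n)) (coord_proj (\<Union>n. A n))"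
  unfolding op_proj_sup_def
proof (intro conjI allI impI op_proj_coord_proj op_proj_le_coord_proj_mono)
  show "A n \<subseteq> (\<Union>n. A n)" for n by blast
  fix R :: "'a op" assume R: "op_proj R" and le: "\<forall>n. op_proj_le (coord_proj (A n)) R"
  have fixed: "R (basis_vec i) = basis_vec i" if "i \<in> A n" for i n
  proof -
    have "R (coord_proj (A n) (basis_vec i)) = coord_proj (A n) (basis_vec i)"
      using le by (simp add: op_proj_le_iff)
    then show ?thesis using that by (simp add: coord_proj_basis_vec)
  qed
  have "R (coord_proj (\<Union>n. A n) x) = coord_proj (\<Union>n. A n) x" for x
  proof (rule op_proj_fixes_supported[OF R diag_op_l2[OF linf_indicator]])
    fix i assume "coord_proj (\<Union>n. A n) x i \<noteq> 0"
    then have "i \<in> (\<Union>n. A n)" by (auto simp: diag_op_def indicator_def split: if_splits)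
    then show "R (basis_vec i) = basis_vec i" using fixed by blast
  qed
  then show "op_proj_le (coord_proj (\<Union>n. A n)) R"
    by (simp add: op_proj_le_iff)
qed

lemma op_compact_coord_proj_singleton: "op_compact (coord_proj {i})"
  unfolding op_compact_def
proof (intro conjI allI impI diag_op_bop linf_indicator)
  fix e :: real assume "e > 0"
  then obtain K where K: "finite K" "cball (0 :: complex) 1 \<subseteq> (\<Union>c\<in>K. ball c e)"
    using compact_cball[of "0 :: complex" 1] unfolding compact_eq_totally_bounded by blast
  let ?F = "(\<lambda>c j. c * basis_vec i j) ` K"
  have "\<exists>y\<in>?F. l2_norm (\<lambda>j. coord_proj {i} x j - y j) < e"
    if x: "x \<in> l2" "l2_norm x \<le> 1" for x
  proof -
    have "x i \<in> cball 0 1" using x cmod_le_l2_norm[of x i] by simp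
    then obtain c where c: "c \<in> K" "dist c (x i) < e" using K by auto
    have "(\<lambda>j. coord_proj {i} x j - c * basis_vec i j) = (\<lambda>j. (x i - c) * basis_vec i j)"
      using x by (auto simp: diag_op_def indicator_def fun_eq_iff)
    then have "l2_norm (\<lambda>j. coord_proj {i} x j - c * basis_vec i j) < e"
      using c
      by (simp only: l2_norm_scale l2_norm_basis_vec) (simp add: dist_norm norm_minus_commute)
    with c(1) show ?thesis by auto
  qed
  moreover have "finite ?F" "?F \<subseteq> l2" using K by (auto simp: l2_scale basis_vec_l2)
  ultimately show "\<exists>F. finite F \<and> F \<subseteq> l2 \<and>
      (\<forall>x\<in>l2. l2_norm x \<le> 1 \<longrightarrow> (\<exists>y\<in>F. l2_norm (\<lambda>j. coord_proj {i} x j - y j) < e))"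
    by blast
qed

lemma diagonal_linf:
  assumes "T \<in> bop"
  shows "diagonal T \<in> linf"
proof -
  obtain K where K: "\<forall>x\<in>l2. l2_norm (T x) \<le> K * l2_norm x"
    using assms by (auto simp: bop_def)
  have "cmod (diagonal T i) \<le> K" for i
  proof -
    have "cmod (diagonal T i) \<le> l2_norm (T (basis_vec i))"
      unfolding diagonal_def by (rule cmod_le_l2_norm[OF bop_l2[OF assms]])
    also have "\<dots> \<le> K" using K basis_vec_l2[of i] l2_norm_basis_vec[of i] by fastforce
    finally show ?thesis .
  qed
  then show ?thesis by (auto simp: linf_iff)
qed

lemma diagonal_op_id: "diagonal op_id = (\<lambda>_. 1)"
  by (simp add: diagonal_def fun_eq_iff op_id_def basis_vec_l2)

lemma diagonal_nonneg:
  assumes "op_positive T"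
  shows "0 \<le> diagonal T i"
proof -
  have "0 \<le> l2_inner (basis_vec i) (T (basis_vec i))"
    using assms by (simp add: op_positive_def cnonneg_iff basis_vec_l2)
  then show ?thesis by (simp add: diagonal_def l2_inner_basis_vec)
qed

lemma diagonal_op_proj:
  assumes "op_proj P"
  shows "diagonal P i = of_real ((l2_norm (P (basis_vec i)))\<^sup>2)"
proof -
  have l2: "P (basis_vec i) \<in> l2" using assms by (simp add: op_proj_def bop_l2)
  have "diagonal P i = P (P (basis_vec i)) i"
    by (simp add: diagonal_def op_proj_idem[OF assms])
  also have "\<dots> = l2_inner (P (basis_vec i)) (P (basis_vec i))"
    by (rule op_proj_apply[OF assms l2])
  finally show ?thesis by (simp add: l2_inner_self[OF l2])
qed

lemma op_proj_le_coord_proj_iff: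
  assumes P: "op_proj P"
  shows "op_proj_le P (coord_proj A) \<longleftrightarrow> (\<forall>i. i \<notin> A \<longrightarrow> diagonal P i = 0)"
proof
  assume "op_proj_le P (coord_proj A)"
  then have "diagonal P i = coord_proj A (P (basis_vec i)) i" for i
    by (simp add: op_proj_le_iff diagonal_def)
  then show "\<forall>i. i \<notin> A \<longrightarrow> diagonal P i = 0"
    by (simp add: diag_op_def)
next
  have P_l2: "P x \<in> l2" for x using P by (simp add: op_proj_def bop_l2)
  assume diagonal: "\<forall>i. i \<notin> A \<longrightarrow> diagonal P i = 0"
  have "P x i = 0" if "i \<notin> A" for x i
  proof (cases "x \<in> l2")
    case True
    have "P (basis_vec i) = (\<lambda>_. 0)"
      using diagonal that by (intro l2_norm_eq_0D P_l2) (simp add: diagonal_op_proj[OF P])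
    then show ?thesis
      by (simp add: op_proj_apply[OF P True] l2_inner_def)
  qed (use P in \<open>simp add: op_proj_def bop_def\<close>)
  then have "coord_proj A (P x) = P x" for x
    using P_l2[of x] by (auto simp: diag_op_def indicator_def fun_eq_iff)
  then show "op_proj_le P (coord_proj A)"
    by (simp add: op_proj_le_iff)
qed

lemma diagonal_op_proj_sup_support:
  assumes q: "\<And>n. op_proj (q n)" and P: "op_proj_sup q P"
  shows "support (diagonal P) \<subseteq> (\<Union>n. support (diagonal (q n)))"
proof -
  let ?A = "\<Union>n. support (diagonal (q n))"
  have "op_proj_le (q n) (coord_proj ?A)" for n
    using q by (auto simp: op_proj_le_coord_proj_iff)
  then have "op_proj_le P (coord_proj ?A)"
    using P op_proj_coord_proj unfolding op_proj_sup_def by blast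
  moreover have "op_proj P" using P by (simp add: op_proj_sup_def)
  ultimately have "\<forall>i. i \<notin> ?A \<longrightarrow> diagonal P i = 0"
    by (simp only: op_proj_le_coord_proj_iff)
  then show ?thesis by blast
qed

lemma op_compact_imp_countable_large_diagonal:
  assumes T: "op_compact T" and "e > 0"
  shows "countable {i. e \<le> cmod (diagonal T i)}"
proof -
  have bop: "T \<in> bop" using T by (simp add: op_compact_def)
  obtain F where F: "finite F" "F \<subseteq> l2"
    "\<And>x. x \<in> l2 \<Longrightarrow> l2_norm x \<le> 1 \<Longrightarrow> \<exists>y\<in>F. l2_norm (\<lambda>j. T x j - y j) < e"
    using T \<open>e > 0\<close> unfolding op_compact_def by meson
  have "i \<in> (\<Union>y\<in>F. support y)" if large: "e \<le> cmod (diagonal T i)" for i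
  proof -
    obtain y where y: "y \<in> F" "l2_norm (\<lambda>j. T (basis_vec i) j - y j) < e"
      using F(3)[of "basis_vec i"] by (auto simp: basis_vec_l2 l2_norm_basis_vec)
    have "(\<lambda>j. T (basis_vec i) j - y j) \<in> l2"
      using F(2) y(1) by (intro l2_diff bop_l2[OF bop]) auto
    from cmod_le_l2_norm[OF this, of i] have "y i \<noteq> 0"
      using y(2) large by (auto simp: diagonal_def)
    with y(1) show ?thesis by blast
  qed
  then have "{i. e \<le> cmod (diagonal T i)} \<subseteq> (\<Union>y\<in>F. support y)" by blast
  moreover have "countable (\<Union>y\<in>F. support y)"
    using F l2_countable_support by (intro countable_UN countable_finite[of F]) auto
  ultimately show ?thesis by (rule countable_subset)
qed

lemma op_compact_imp_countable_diagonal_support: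
  assumes "op_compact T"
  shows "countable (support (diagonal T))"
proof (rule countable_subset)
  let ?large = "\<lambda>n. {i. inverse (real (Suc n)) \<le> cmod (diagonal T i)}"
  show "support (diagonal T) \<subseteq> (\<Union>n. ?large n)"
  proof
    fix i assume "i \<in> support (diagonal T)"
    then obtain n where "inverse (real (Suc n)) < cmod (diagonal T i)"
      using reals_Archimedean[of "cmod (diagonal T i)"] by auto
    then show "i \<in> (\<Union>n. ?large n)"
      by (blast intro: less_imp_le)
  qed
  show "countable (\<Union>n. ?large n)"
    by (intro countable_UN op_compact_imp_countable_large_diagonal[OF assms]) simp_all
qed

section \<open>States on bounded operators\<close>

lemma linf_state_comp_diag_op:
  assumes "bop_state \<phi>"
  shows "linf_state (\<phi> \<circ> diag_op)"
  using assms unfolding linf_state_def bop_state_def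
  by (simp add: diag_op_add diag_op_scale diag_op_one diag_op_bop diag_op_positive cnonneg_iff)

lemma linf_regular_comp_diag_op:
  fixes \<phi> :: "'a op \<Rightarrow> complex"
  assumes "bop_regular \<phi>"
  shows "linf_regular (\<phi> \<circ> diag_op)"
  unfolding linf_regular_iff comp_apply
proof (intro allI impI)
  fix A :: "nat \<Rightarrow> 'a set" assume "\<forall>n. \<phi> (coord_proj (A n)) = 0"
  then show "\<phi> (coord_proj (\<Union>n. A n)) = 0"
    using assms[unfolded bop_regular_def, rule_format, OF op_proj_coord_proj _
        op_proj_sup_coord_proj] by simp
qed

lemma linf_singular_comp_diag_op:
  assumes "bop_state \<phi>" "bop_singular \<phi>"
  shows "linf_singular (\<phi> \<circ> diag_op)"
  using assms
  by (simp add: linf_singular_iff[OF linf_state_comp_diag_op] bop_singular_def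
      op_compact_coord_proj_singleton)

lemma bop_state_comp_diagonal:
  assumes "linf_state \<psi>"
  shows "bop_state (\<psi> \<circ> diagonal)"
proof -
  have "\<psi> (diagonal (op_add S T)) = \<psi> (diagonal S) + \<psi> (diagonal T)" if "S \<in> bop" "T \<in> bop" for S T
    using linf_state_add[OF assms diagonal_linf[OF that(1)] diagonal_linf[OF that(2)]]
    by (simp add: diagonal_def[abs_def] op_add_def)
  moreover have "\<psi> (diagonal (op_scale c T)) = c * \<psi> (diagonal T)" if "T \<in> bop" for c T
    using linf_state_scale[OF assms diagonal_linf[OF that], of c]
    by (simp add: diagonal_def[abs_def] op_scale_def)
  moreover have "0 \<le> \<psi> (diagonal T)" if "op_positive T" for T
    using that by (intro linf_state_nonneg[OF assms] diagonal_linf diagonal_nonneg)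
      (simp add: op_positive_def)
  moreover have "\<psi> (diagonal op_id) = 1"
    using assms by (simp add: diagonal_op_id linf_state_def)
  ultimately show ?thesis
    by (simp add: bop_state_def cnonneg_iff)
qed

lemma bop_regular_comp_diagonal:
  assumes state: "linf_state \<psi>" and regular: "linf_regular \<psi>"
  shows "bop_regular (\<psi> \<circ> diagonal)"
  unfolding bop_regular_def comp_apply
proof (intro allI impI)
  fix q :: "nat \<Rightarrow> 'a op" and P
  assume q: "\<forall>n. op_proj (q n)" "\<forall>n. \<psi> (diagonal (q n)) = 0" and P: "op_proj_sup q P"
  have "\<psi> (indicator (support (diagonal (q n)))) = 0" for n
  proof (rule linf_state_support_null[OF state regular])
    show "diagonal (q n) \<in> linf" using q(1) by (simp add: op_proj_def diagonal_linf)
    show "0 \<le> diagonal (q n) i" for i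
      using q(1) by (simp add: diagonal_op_proj less_eq_complex_def)
    show "\<psi> (diagonal (q n)) = 0" using q(2) by simp
  qed
  then have null: "\<psi> (indicator (\<Union>n. support (diagonal (q n)))) = 0"
    using regular by (simp add: linf_regular_iff)
  have "diagonal P \<in> linf"
    using P by (simp add: op_proj_sup_def op_proj_def diagonal_linf)
  moreover have "support (diagonal P) \<subseteq> (\<Union>n. support (diagonal (q n)))"
    using q(1) by (intro diagonal_op_proj_sup_support[OF _ P]) simp
  ultimately show "\<psi> (diagonal P) = 0"
    using null by (rule linf_state_eq_0_if_null_support[OF state])
qed

lemma bop_singular_comp_diagonal:
  assumes state: "linf_state \<psi>" and "linf_regular \<psi>" "linf_singular \<psi>"
  shows "bop_singular (\<psi> \<circ> diagonal)"
  unfolding bop_singular_def comp_apply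
proof (intro allI impI)
  fix T :: "'a op" assume T: "op_compact T"
  interpret regular_singular_charge "state_charge \<psi>"
    using assms by (rule regular_singular_charge_state_charge)
  have "diagonal T \<in> linf"
    using T by (simp add: op_compact_def diagonal_linf)
  moreover have "\<psi> (indicator (support (diagonal T))) = 0"
    using null_countable[OF op_compact_imp_countable_diagonal_support[OF T]]
    by (simp add: state_charge_eq_0_iff[OF state])
  ultimately show "\<psi> (diagonal T) = 0"
    by (rule linf_state_eq_0_if_null_support[OF state _ subset_refl])
qed

lemma ex_regular_singular_bop_state_iff:
  "(\<exists>\<phi> :: 'a op \<Rightarrow> complex. bop_state \<phi> \<and> bop_regular \<phi> \<and> bop_singular \<phi>) \<longleftrightarrow>
   (\<exists>\<psi> :: ('a \<Rightarrow> complex) \<Rightarrow> complex. linf_state \<psi> \<and> linf_regular \<psi> \<and> linf_singular \<psi>)"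
proof
  assume "\<exists>\<phi> :: 'a op \<Rightarrow> complex. bop_state \<phi> \<and> bop_regular \<phi> \<and> bop_singular \<phi>"
  then obtain \<phi> :: "'a op \<Rightarrow> complex"
    where "bop_state \<phi>" "bop_regular \<phi>" "bop_singular \<phi>" by blast
  then show "\<exists>\<psi> :: ('a \<Rightarrow> complex) \<Rightarrow> complex. linf_state \<psi> \<and> linf_regular \<psi> \<and> linf_singular \<psi>"
    by (intro exI[of _ "\<phi> \<circ> diag_op"] conjI linf_state_comp_diag_op linf_regular_comp_diag_op
        linf_singular_comp_diag_op)
next
  assume "\<exists>\<psi> :: ('a \<Rightarrow> complex) \<Rightarrow> complex. linf_state \<psi> \<and> linf_regular \<psi> \<and> linf_singular \<psi>"
  then obtain \<psi> :: "('a \<Rightarrow> complex) \<Rightarrow> complex"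
    where "linf_state \<psi>" "linf_regular \<psi>" "linf_singular \<psi>" by blast
  then show "\<exists>\<phi> :: 'a op \<Rightarrow> complex. bop_state \<phi> \<and> bop_regular \<phi> \<and> bop_singular \<phi>"
    by (intro exI[of _ "\<psi> \<circ> diagonal"] conjI bop_state_comp_diagonal bop_regular_comp_diagonal
        bop_singular_comp_diagonal)
qed

theorem theorem8p4:
  assumes CH: "continuum_hypothesis"
    and inf: "infinite (UNIV :: 'a set)"
  shows "((\<exists>\<phi> :: ('a \<Rightarrow> complex) \<Rightarrow> complex.
              linf_state \<phi> \<and> linf_regular \<phi> \<and> linf_singular \<phi>)
            \<longleftrightarrow> ulam_measurable TYPE('a))
       \<and> ((\<exists>\<phi> :: 'a op \<Rightarrow> complex.
              bop_state \<phi> \<and> bop_regular \<phi> \<and> bop_singular \<phi>)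
            \<longleftrightarrow> ulam_measurable TYPE('a))"
proof -
  have "(\<exists>\<phi> :: ('a \<Rightarrow> complex) \<Rightarrow> complex. linf_state \<phi> \<and> linf_regular \<phi> \<and> linf_singular \<phi>)
      \<longleftrightarrow> ulam_measurable TYPE('a)"
    using regular_singular_linf_state_imp_ulam_measurable[OF CH]
      ulam_measurable_imp_ex_regular_singular_linf_state by blast
  then show ?thesis by (simp only: ex_regular_singular_bop_state_iff)
qed

end
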